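(* There exists an absolute constant $C>0$ such that the following holds. Let $u$ be a linear operator on $\ell_2^N$ with $\|u\|=1$, and let $n$ be an integer with $2\le n\le N$. Let $\sigma$ be a random subset of $\{1,\dots,N\}$, uniformly distributed among all subsets of cardinality $n$. Then $$\mathbb{E}\,\big\|u|_{\mathbb{R}^\sigma}\big\|\le C\log n\Big(\sqrt{\frac{n}{N}}+\max_{1\le j\le N}\|ue_j\|\Big).$$
   Context: $\ell_2^N$ is $\mathbb{R}^N$ with the Euclidean norm and canonical basis $e_1,\dots,e_N$. For $\sigma\subset\{1,\dots,N\}$, $\mathbb{R}^\sigma$ is the coordinate subspace spanned by $\{e_j: j\in\sigma\}$, and $u|_{\mathbb{R}^\sigma}$ is the restriction of $u$ to it. $\|\cdot\|$ denotes the Euclidean norm of vectors and the operator norm of operators. *)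

theory Defs
  imports
    "HOL-Probability.Probability_Mass_Function"
    "Jordan_Normal_Form.VS_Connect"
begin

hide_type (open) Finite_Cartesian_Product.vec
unbundle no vec_syntax

text \<open>
  An absolute constant has to be chosen before the dimension \<open>N\<close>, so the space
  \<open>\<real>\<^sup>N\<close> is taken as \<^term>\<open>carrier_vec N\<close> with \<open>N\<close> a natural number rather than a type.
  Coordinates are numbered \<open>0, \<dots>, N - 1\<close>; \<^term>\<open>unit_vec N j\<close> is the canonical basis.
\<close>

definition enorm :: "real vec \<Rightarrow> real" where
  "enorm x = L2_set (vec_index x) {..<dim_vec x}"

abbreviation linear_operator :: "nat \<Rightarrow> (real vec \<Rightarrow> real vec) \<Rightarrow> bool" where
  "linear_operator N \<equiv>
     linear_map class_ring (module_vec TYPE(real) N) (module_vec TYPE(real) N)"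

definition coord_subspace :: "nat \<Rightarrow> nat set \<Rightarrow> real vec set" where
  "coord_subspace N \<sigma> =
     LinearCombinations.module.span class_ring (module_vec TYPE(real) N) (unit_vec N ` \<sigma>)"

text \<open>
  Operator norm of the restriction of \<open>u\<close> to the subspace \<open>W\<close>. The supremum is over a
  bounded set of reals whenever \<open>u\<close> is linear on \<^term>\<open>carrier_vec N\<close> and
  \<open>W \<subseteq> carrier_vec N\<close> (see \<open>bdd_above_opnorm_on\<close> below).
\<close>

definition opnorm_on :: "real vec set \<Rightarrow> (real vec \<Rightarrow> real vec) \<Rightarrow> real" where
  "opnorm_on W u = (SUP x\<in>{x \<in> W. enorm x \<le> 1}. enorm (u x))"

definition random_subset :: "nat \<Rightarrow> nat \<Rightarrow> nat set pmf" where
  "random_subset N n = pmf_of_set {\<sigma>. \<sigma> \<subseteq> {..<N} \<and> card \<sigma> = n}"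

lemma linear_operator_iff:
  "linear_operator N u \<longleftrightarrow>
     u \<in> carrier_vec N \<rightarrow> carrier_vec N \<and>
     (\<forall>x\<in>carrier_vec N. \<forall>y\<in>carrier_vec N. u (x + y) = u x + u y) \<and>
     (\<forall>c. \<forall>x\<in>carrier_vec N. u (c \<cdot>\<^sub>v x) = c \<cdot>\<^sub>v u x)"
proof -
  interpret vec_space "TYPE(real)" N .
  have "linear_operator N u \<longleftrightarrow> mod_hom class_ring V V u"
    unfolding linear_map_def mod_hom_def
    using vec_vs vec_module by blast
  also have "\<dots> \<longleftrightarrow> u \<in> LinearCombinations.module_hom class_ring V V"
    unfolding mod_hom_def mod_hom_axioms_def using vec_module by blast
  finally show ?thesis
    unfolding LinearCombinations.module_hom_def by (auto simp: module_vec_simps)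
qed

lemma coord_subspace_eq:
  assumes "\<sigma> \<subseteq> {..<N}"
  shows "coord_subspace N \<sigma> = {x \<in> carrier_vec N. \<forall>i<N. i \<notin> \<sigma> \<longrightarrow> x $ i = 0}"
proof -
  interpret vec_space "TYPE(real)" N .
  have fin: "finite (unit_vec N ` \<sigma>)" using assms finite_subset by blast
  have car: "unit_vec N ` \<sigma> \<subseteq> carrier_vec N" by auto
  have index: "lincomb a (unit_vec N ` \<sigma>) $ i = (if i \<in> \<sigma> then a (unit_vec N i) else 0)"
    if "i < N" for a i
  proof -
    have inj: "inj_on (unit_vec N :: nat \<Rightarrow> real vec) \<sigma>"
      by (rule inj_onI) (use assms in auto)
    have "lincomb a (unit_vec N ` \<sigma>) $ i = (\<Sum>j\<in>\<sigma>. a (unit_vec N j) * unit_vec N j $ i)"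
      using lincomb_index[OF that car] inj by (simp add: sum.reindex)
    also have "\<dots> = (\<Sum>j\<in>\<sigma>. if j = i then a (unit_vec N j) else 0)"
      using assms that by (intro sum.cong) (auto simp: unit_vec_def)
    also have "\<dots> = (if i \<in> \<sigma> then a (unit_vec N i) else 0)"
      using assms finite_subset[OF assms] by simp
    finally show ?thesis .
  qed
  have "x \<in> span (unit_vec N ` \<sigma>) \<longleftrightarrow>
      x \<in> carrier_vec N \<and> (\<forall>i<N. i \<notin> \<sigma> \<longrightarrow> x $ i = 0)" (is "?L \<longleftrightarrow> ?R") for x
  proof
    assume ?L
    then obtain a where x: "x = lincomb a (unit_vec N ` \<sigma>)"
      using finite_span[OF fin car] by auto
    then show ?R using index lincomb_dim[OF fin car] by auto
  next
    assume R: ?R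
    define a :: "real vec \<Rightarrow> real" where "a = (\<lambda>v. x $ (THE j. j < N \<and> v = unit_vec N j))"
    have a: "a (unit_vec N i) = x $ i" if "i < N" for i
    proof -
      have "(THE j. j < N \<and> (unit_vec N i :: real vec) = unit_vec N j) = i"
        using that by (intro the_equality) auto
      then show ?thesis by (simp add: a_def)
    qed
    have "x = lincomb a (unit_vec N ` \<sigma>)"
      using R lincomb_dim[OF fin car, of a] by (intro eq_vecI) (auto simp: index a)
    then show ?L using finite_span[OF fin car] by auto
  qed
  then show ?thesis by (auto simp: coord_subspace_def)
qed

lemma linear_operator_index:
  assumes "linear_operator N u" "x \<in> carrier_vec N" "i < N"
  shows "u x $ i = (\<Sum>j<N. x $ j * u (unit_vec N j) $ i)"
proof -
  have cl: "u y \<in> carrier_vec N" if "y \<in> carrier_vec N" for y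
    using that assms(1) by (auto simp: linear_operator_iff)
  have add: "u (y + z) = u y + u z" if "y \<in> carrier_vec N" "z \<in> carrier_vec N" for y z
    using that assms(1) by (auto simp: linear_operator_iff)
  have sc: "u (c \<cdot>\<^sub>v y) = c \<cdot>\<^sub>v u y" if "y \<in> carrier_vec N" for c y
    using that assms(1) by (auto simp: linear_operator_iff)
  define t where "t = (\<lambda>m. vec N (\<lambda>k. if k < m then x $ k else 0))"
  have t: "t m \<in> carrier_vec N" for m by (simp add: t_def)
  have "u (t m) $ i = (\<Sum>j<m. x $ j * u (unit_vec N j) $ i)" if "m \<le> N" for m
    using that
  proof (induction m)
    case 0
    have "t 0 = 0 \<cdot>\<^sub>v t 0" by (intro eq_vecI) (auto simp: t_def)
    then have "u (t 0) = 0 \<cdot>\<^sub>v u (t 0)" using sc[OF t] by metis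
    also have "(0 \<cdot>\<^sub>v u (t 0)) $ i = 0" using cl[OF t, of 0] assms(3) by auto
    finally show ?case by simp
  next
    case (Suc m)
    have "t (Suc m) = t m + x $ m \<cdot>\<^sub>v unit_vec N m"
      using Suc.prems by (intro eq_vecI) (auto simp: t_def less_Suc_eq)
    then have "u (t (Suc m)) = u (t m) + x $ m \<cdot>\<^sub>v u (unit_vec N m)"
      using add[OF t] sc by simp
    then show ?case
      using Suc cl[OF t, of m] cl[OF unit_vec_carrier, of m] assms(3) by auto
  qed
  from this[of N] have "u (t N) $ i = (\<Sum>j<N. x $ j * u (unit_vec N j) $ i)" by simp
  moreover have "t N = x" using assms(2) by (intro eq_vecI) (auto simp: t_def)
  ultimately show ?thesis by simp
qed

lemma bdd_above_opnorm_on: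
  assumes "linear_operator N u" "W \<subseteq> carrier_vec N"
  shows "bdd_above ((\<lambda>x. enorm (u x)) ` {x \<in> W. enorm x \<le> 1})"
proof -
  have "enorm (u x) \<le> (\<Sum>i<N. \<Sum>j<N. \<bar>u (unit_vec N j) $ i\<bar>)"
    if x: "x \<in> carrier_vec N" "enorm x \<le> 1" for x
  proof -
    have xj: "\<bar>x $ j\<bar> \<le> 1" if "j < N" for j
    proof -
      have "\<bar>x $ j\<bar> \<le> L2_set (\<lambda>k. \<bar>x $ k\<bar>) {..<N}"
        using that by (intro member_le_L2_set) auto
      also have "\<dots> = enorm x" using x(1) by (auto simp: enorm_def L2_set_def)
      finally show ?thesis using x(2) by simp
    qed
    have "u x \<in> carrier_vec N" using x(1) assms(1) by (auto simp: linear_operator_iff)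
    then have "enorm (u x) \<le> (\<Sum>i<N. \<bar>u x $ i\<bar>)"
      unfolding enorm_def using L2_set_le_sum_abs by auto
    also have "\<dots> \<le> (\<Sum>i<N. \<Sum>j<N. \<bar>u (unit_vec N j) $ i\<bar>)"
    proof (intro sum_mono)
      fix i assume "i \<in> {..<N}"
      then have "\<bar>u x $ i\<bar> \<le> (\<Sum>j<N. \<bar>x $ j * u (unit_vec N j) $ i\<bar>)"
        using linear_operator_index[OF assms(1) x(1)] sum_abs by simp
      also have "\<dots> \<le> (\<Sum>j<N. \<bar>u (unit_vec N j) $ i\<bar>)"
        using xj by (intro sum_mono) (auto simp: abs_mult intro: mult_left_le_one_le)
      finally show "\<bar>u x $ i\<bar> \<le> (\<Sum>j<N. \<bar>u (unit_vec N j) $ i\<bar>)" .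
    qed
    finally show ?thesis .
  qed
  then show ?thesis using assms(2) by (auto intro!: bdd_aboveI)
qed

end

theory Submission
  imports Defs
begin

text \<open>
  Write \<open>a\<^sub>j = u e\<^sub>j\<close> and \<open>X\<^sub>\<sigma> = \<Sum>\<^sub>j\<^sub>\<in>\<^sub>\<sigma> a\<^sub>j a\<^sub>j\<^sup>T\<close>. Then \<open>\<parallel>u|\<^sub>\<sigma>\<parallel>\<^sup>2 = \<parallel>X\<^sub>\<sigma>\<parallel>\<close>, and the norm of \<open>X\<^sub>\<sigma>\<close> is
  controlled by the moment method: \<open>\<parallel>X\<^sub>\<sigma>\<parallel>\<^sup>p \<le> tr X\<^sub>\<sigma>\<^sup>p\<close> for an even \<open>p\<close> of order \<open>log n\<close>.

  The traces satisfy \<open>tr X\<^sub>\<sigma>\<^sup>k\<^sup>+\<^sup>1 = \<Sum>\<^sub>j\<^sub>\<in>\<^sub>\<sigma> \<langle>a\<^sub>j, X\<^sub>\<sigma>\<^sup>k a\<^sub>j\<rangle>\<close>. In each summand the matrix contains the vector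
  against which it is tested. The heart of the proof is that the vector can be removed at the price
  of a scalar shift: if \<open>Y = X\<^sub>\<sigma> - a a\<^sup>T\<close> and \<open>\<parallel>a\<parallel>\<^sup>2 \<le> b\<close>, then
  \<open>\<langle>a, X\<^sub>\<sigma>\<^sup>k a\<rangle> \<le> \<langle>a, (Y + b)\<^sup>k a\<rangle>\<close> (lemma \<open>moment_insert_le\<close>). Indeed the left side expands into
  products of the numbers \<open>\<langle>a, Y\<^sup>i a\<rangle>\<close>; these are the moments of a positive measure on the half
  line, hence log-convex, so such a product is at most a power of the total mass
  \<open>\<parallel>a\<parallel>\<^sup>2\<close> times a single moment.

  After the removal, a pair \<open>(\<sigma>, j)\<close> with \<open>j \<in> \<sigma>\<close> enters only through \<open>j\<close> and the
  \<open>(n - 1)\<close>-element set \<open>\<tau> = \<sigma> - {j}\<close>. Since the terms are nonnegative, \<open>j\<close> may then run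
  over all indices, and as \<open>u\<close> is a contraction, \<open>\<Sum>\<^sub>j \<langle>a\<^sub>j, X\<^sub>\<tau>\<^sup>l a\<^sub>j\<rangle> \<le> tr X\<^sub>\<tau>\<^sup>l\<close>
  (lemma \<open>sum_moment_le_trace_power\<close>). For \<open>2 n \<le> N\<close>, passing from \<open>n\<close>-sets to
  \<open>(n - 1)\<close>-sets costs a factor \<open>\<delta> = 2 n / N\<close>, so
  \<open>\<E> tr X\<^sup>k\<^sup>+\<^sup>1 \<le> \<delta> \<Sum>\<^sub>l (k choose l) b\<^sup>k\<^sup>-\<^sup>l \<E> tr X\<^sup>l\<close>,
  where the term \<open>l = 0\<close> is replaced by \<open>\<Sum>\<^sub>j \<parallel>a\<^sub>j\<parallel>\<^sup>2 \<le> N b\<close>. This is the recursion for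
  the moments of a Poisson variable, and it gives \<open>\<E> tr X\<^sup>p \<le> 2 n (b p + \<delta>)\<^sup>p\<close>
  (lemma \<open>sum_trace_power_bound\<close>). With \<open>p\<close> at least \<open>log n\<close> the factor \<open>n\<close> is absorbed and
  \<open>\<E> \<parallel>u|\<^sub>\<sigma>\<parallel> \<le> 6 sqrt (b p + \<delta>)\<close>. When \<open>2 n > N\<close>, the trivial bound \<open>1\<close> is already of the
  order of \<open>sqrt (n / N)\<close>.
\<close>

section \<open>Log-convex sequences and binomial sums\<close>

text \<open>
  Log-convexity says that the ratios \<open>m (k + 1) / m k\<close> increase, so moving one unit from the smaller
  index to the larger one increases a product of two terms; repeating this moves everything to
  one index.
\<close>

lemma log_convex_mult_le:
  fixes m :: "nat \<Rightarrow> real"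
  assumes nonneg: "\<And>k. 0 \<le> m k"
    and log_convex: "\<And>k. (m (Suc k))\<^sup>2 \<le> m k * m (Suc (Suc k))"
  shows "m i * m j \<le> m 0 * m (i + j)"
proof -
  have shift: "m (Suc k) * m (k + d) \<le> m k * m (Suc (k + d))" for k d
  proof (induction d)
    case 0
    show ?case by simp
  next
    case (Suc d)
    let ?l = "k + d"
    show ?case
    proof (cases "m ?l = 0")
      case True
      then have "(m (Suc ?l))\<^sup>2 \<le> 0" using log_convex[of ?l] by simp
      then show ?thesis using nonneg by simp
    next
      case False
      then have pos: "0 < m ?l" using nonneg[of ?l] by simp
      have "m ?l * (m (Suc k) * m (Suc ?l)) \<le> (m k * m (Suc ?l)) * m (Suc ?l)"
        using mult_right_mono[OF Suc.IH nonneg[of "Suc ?l"]] by (simp add: mult_ac)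
      also have "\<dots> \<le> m k * (m ?l * m (Suc (Suc ?l)))"
        using mult_left_mono[OF log_convex[of ?l] nonneg[of k]]
        by (simp add: power2_eq_square mult_ac)
      finally have "m ?l * (m (Suc k) * m (Suc ?l)) \<le> m ?l * (m k * m (Suc (Suc ?l)))"
        by (simp add: mult_ac)
      then show ?thesis using pos by simp
    qed
  qed
  have ordered: "m i * m (i + d) \<le> m 0 * m (i + (i + d))" for i d
  proof (induction i arbitrary: d)
    case 0
    show ?case by simp
  next
    case (Suc i)
    have "m (Suc i) * m (i + Suc d) \<le> m i * m (i + Suc (Suc d))"
      using shift[of i "Suc d"] by simp
    also have "\<dots> \<le> m 0 * m (i + (i + Suc (Suc d)))" by (rule Suc.IH)
    finally show ?case by simp
  qed
  show ?thesis
  proof (cases "i \<le> j")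
    case True
    then show ?thesis using ordered[of i "j - i"] by simp
  next
    case False
    then show ?thesis using ordered[of j "i - j"] by (simp add: mult.commute add.commute)
  qed
qed

text \<open>
  For moments of a positive measure this is Jensen's inequality for \<open>t \<mapsto> t\<^sup>p\<^sup>+\<^sup>1\<close>.
\<close>

lemma log_convex_power_le:
  fixes m :: "nat \<Rightarrow> real"
  assumes nonneg: "\<And>k. 0 \<le> m k"
    and log_convex: "\<And>k. (m (Suc k))\<^sup>2 \<le> m k * m (Suc (Suc k))"
  shows "m 1 ^ Suc p \<le> m 0 ^ p * m (Suc p)"
proof (induction p)
  case 0
  show ?case by simp
next
  case (Suc p)
  have "m 1 ^ Suc (Suc p) \<le> m 1 * (m 0 ^ p * m (Suc p))"
    using mult_left_mono[OF Suc.IH nonneg[of 1]] by simp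
  also have "\<dots> = m 0 ^ p * (m 1 * m (Suc p))" by simp
  also have "\<dots> \<le> m 0 ^ p * (m 0 * m (1 + Suc p))"
    by (intro mult_left_mono log_convex_mult_le) (use nonneg log_convex in auto)
  finally show ?case by (simp add: mult_ac)
qed

lemma sum_binomial_Suc:
  fixes f :: "nat \<Rightarrow> real"
  shows "(\<Sum>l\<le>Suc m. real (Suc m choose l) * b ^ (Suc m - l) * f l) =
    (\<Sum>l\<le>m. real (m choose l) * b ^ (m - l) * f (Suc l)) +
    b * (\<Sum>l\<le>m. real (m choose l) * b ^ (m - l) * f l)"
proof -
  have "(\<Sum>l\<le>Suc m. real (Suc m choose l) * b ^ (Suc m - l) * f l) =
      b ^ Suc m * f 0 + (\<Sum>l\<le>m. real (Suc m choose Suc l) * b ^ (m - l) * f (Suc l))"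
    by (subst sum.atMost_Suc_shift) simp
  also have "\<dots> = (\<Sum>l\<le>m. real (m choose l) * b ^ (m - l) * f (Suc l)) +
      (b ^ Suc m * f 0 + (\<Sum>l\<le>m. real (m choose Suc l) * b ^ (m - l) * f (Suc l)))"
    by (simp add: sum.distrib algebra_simps)
  also have "b ^ Suc m * f 0 + (\<Sum>l\<le>m. real (m choose Suc l) * b ^ (m - l) * f (Suc l)) =
      (\<Sum>l\<le>Suc m. real (m choose l) * b ^ (Suc m - l) * f l)"
    by (subst sum.atMost_Suc_shift) simp
  also have "\<dots> = (\<Sum>l\<le>m. b * (real (m choose l) * b ^ (m - l) * f l))"
    by (simp add: Suc_diff_le mult_ac)
  finally show ?thesis by (simp add: sum_distrib_left)
qed

text \<open>
  The bijection \<open>(\<sigma>, j) \<mapsto> (\<sigma> - {j}, j)\<close> is the substitute, for sampling without replacement, of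
  the independence of the events \<open>j \<in> \<sigma>\<close>.
\<close>

lemma sum_subsets_remove:
  fixes g :: "'a \<Rightarrow> 'a set \<Rightarrow> real"
  assumes J: "finite J"
  shows "(\<Sum>\<sigma> | \<sigma> \<subseteq> J \<and> card \<sigma> = Suc m. \<Sum>j\<in>\<sigma>. g j (\<sigma> - {j})) =
    (\<Sum>\<tau> | \<tau> \<subseteq> J \<and> card \<tau> = m. \<Sum>j\<in>J - \<tau>. g j \<tau>)"
proof -
  have fin: "finite {\<sigma>. \<sigma> \<subseteq> J \<and> card \<sigma> = k}" for k using J by simp
  have fin': "finite \<sigma>" if "\<sigma> \<subseteq> J" for \<sigma> using that J finite_subset by blast
  have "(\<Sum>\<sigma> | \<sigma> \<subseteq> J \<and> card \<sigma> = Suc m. \<Sum>j\<in>\<sigma>. g j (\<sigma> - {j})) =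
      (\<Sum>(\<sigma>, j)\<in>(SIGMA \<sigma>:{\<sigma>. \<sigma> \<subseteq> J \<and> card \<sigma> = Suc m}. \<sigma>). g j (\<sigma> - {j}))"
    using fin fin' by (intro sum.Sigma) auto
  also have "\<dots> = (\<Sum>(\<tau>, j)\<in>(SIGMA \<tau>:{\<tau>. \<tau> \<subseteq> J \<and> card \<tau> = m}. J - \<tau>). g j \<tau>)"
    by (rule sum.reindex_bij_witness[of _ "\<lambda>(\<tau>, j). (insert j \<tau>, j)" "\<lambda>(\<sigma>, j). (\<sigma> - {j}, j)"])
      (auto simp: insert_absorb card_insert_if fin')
  also have "\<dots> = (\<Sum>\<tau> | \<tau> \<subseteq> J \<and> card \<tau> = m. \<Sum>j\<in>J - \<tau>. g j \<tau>)"
    using fin J by (intro sum.Sigma[symmetric]) auto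
  finally show ?thesis .
qed

section \<open>Frame operators and their moments\<close>

text \<open>
  Vectors are real functions on a finite index set, so that the dimension is a term and not a type;
  only their values on \<open>I\<close> matter.
\<close>

locale vector_system =
  fixes I :: "'i set" and a :: "'j \<Rightarrow> 'i \<Rightarrow> real"
  assumes finite_I: "finite I"
begin

definition dot :: "('i \<Rightarrow> real) \<Rightarrow> ('i \<Rightarrow> real) \<Rightarrow> real" where
  "dot f g = (\<Sum>i\<in>I. f i * g i)"

definition frame_op :: "'j set \<Rightarrow> ('i \<Rightarrow> real) \<Rightarrow> 'i \<Rightarrow> real" where
  "frame_op \<sigma> f = (\<lambda>i. \<Sum>j\<in>\<sigma>. dot (a j) f * a j i)"

definition moment :: "'j set \<Rightarrow> nat \<Rightarrow> ('i \<Rightarrow> real) \<Rightarrow> real" where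
  "moment \<sigma> k f = dot f ((frame_op \<sigma> ^^ k) f)"

definition basis :: "'i \<Rightarrow> 'i \<Rightarrow> real" where
  "basis i = (\<lambda>r. of_bool (r = i))"

definition trace_power :: "'j set \<Rightarrow> nat \<Rightarrow> real" where
  "trace_power \<sigma> k = (\<Sum>i\<in>I. moment \<sigma> k (basis i))"

lemma dot_commute: "dot f g = dot g f"
  by (simp add: dot_def mult.commute)

lemma dot_self_nonneg: "0 \<le> dot f f"
  by (simp add: dot_def sum_nonneg)

lemma dot_Cauchy_Schwarz: "(dot f g)\<^sup>2 \<le> dot f f * dot g g"
  using Cauchy_Schwarz_ineq_sum[of f g I] by (simp add: dot_def power2_eq_square)

lemma dot_basis: "i \<in> I \<Longrightarrow> dot (basis i) f = f i"
  using finite_I by (simp add: dot_def basis_def of_bool_def if_distrib if_distribR cong: if_cong)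

lemma dot_Parseval: "dot f g = (\<Sum>i\<in>I. dot (basis i) f * dot (basis i) g)"
proof -
  have "dot f g = (\<Sum>i\<in>I. f i * g i)" by (rule dot_def)
  then show ?thesis by (simp add: dot_basis)
qed

lemma dot_frame_op: "dot f (frame_op \<sigma> g) = (\<Sum>j\<in>\<sigma>. dot (a j) f * dot (a j) g)"
proof -
  have "dot f (frame_op \<sigma> g) = (\<Sum>i\<in>I. \<Sum>j\<in>\<sigma>. dot (a j) g * (a j i * f i))"
    by (simp add: dot_def[of f] frame_op_def sum_distrib_left mult_ac)
  also have "\<dots> = (\<Sum>j\<in>\<sigma>. \<Sum>i\<in>I. dot (a j) g * (a j i * f i))"
    by (rule sum.swap)
  finally show ?thesis by (simp add: dot_def[of _ f] sum_distrib_left mult.commute)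
qed

lemma frame_op_self_adjoint: "dot f (frame_op \<sigma> g) = dot (frame_op \<sigma> f) g"
  by (simp add: dot_frame_op dot_commute[of "frame_op \<sigma> f"] mult.commute)

lemma frame_op_power_self_adjoint:
  "dot f ((frame_op \<sigma> ^^ k) g) = dot ((frame_op \<sigma> ^^ k) f) g"
proof (induction k arbitrary: f)
  case (Suc k)
  then show ?case by (simp add: frame_op_self_adjoint funpow_swap1[of _ k f])
qed simp

lemma dot_frame_op_power_swap:
  "dot f ((frame_op \<sigma> ^^ k) g) = dot g ((frame_op \<sigma> ^^ k) f)"
  by (simp only: frame_op_power_self_adjoint[of f] dot_commute[of g])

lemma dot_power_power:
  "dot ((frame_op \<sigma> ^^ k) f) ((frame_op \<sigma> ^^ l) g) = dot f ((frame_op \<sigma> ^^ (k + l)) g)"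
  by (simp add: frame_op_power_self_adjoint[symmetric] funpow_add)

lemma moment_even: "moment \<sigma> (2 * h) f = dot ((frame_op \<sigma> ^^ h) f) ((frame_op \<sigma> ^^ h) f)"
  by (simp add: moment_def dot_power_power mult_2)

lemma moment_odd:
  "moment \<sigma> (Suc (2 * h)) f = (\<Sum>j\<in>\<sigma>. (dot (a j) ((frame_op \<sigma> ^^ h) f))\<^sup>2)"
proof -
  have "moment \<sigma> (Suc (2 * h)) f = dot ((frame_op \<sigma> ^^ h) f) ((frame_op \<sigma> ^^ Suc h) f)"
    by (simp only: moment_def dot_power_power) (simp add: mult_2)
  then show ?thesis by (simp add: dot_frame_op power2_eq_square)
qed

lemma moment_nonneg: "0 \<le> moment \<sigma> k f"
proof (cases "even k")
  case True
  then show ?thesis by (auto elim!: evenE simp: moment_even dot_self_nonneg)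
next
  case False
  then show ?thesis by (auto elim!: oddE simp: moment_odd sum_nonneg)
qed

text \<open>
  Cauchy-Schwarz for the positive form \<open>\<langle>f, g\<rangle>\<close> when \<open>k\<close> is even and for \<open>\<langle>f, X g\<rangle>\<close> when \<open>k\<close> is
  odd, applied to two consecutive iterates of \<open>f\<close>.
\<close>

lemma moment_log_convex:
  "(moment \<sigma> (Suc k) f)\<^sup>2 \<le> moment \<sigma> k f * moment \<sigma> (Suc (Suc k)) f"
proof (cases "even k")
  case True
  then obtain h where k: "k = 2 * h" by (auto elim: evenE)
  have "moment \<sigma> (Suc k) f = dot ((frame_op \<sigma> ^^ h) f) ((frame_op \<sigma> ^^ Suc h) f)"
    by (simp only: moment_def dot_power_power) (simp add: k mult_2)
  then show ?thesis
    using dot_Cauchy_Schwarz moment_even[of \<sigma> h f] moment_even[of \<sigma> "Suc h" f]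
    by (simp add: k)
next
  case False
  then obtain h where k: "k = Suc (2 * h)" by (auto elim: oddE)
  have "moment \<sigma> (Suc k) f = dot ((frame_op \<sigma> ^^ h) f) ((frame_op \<sigma> ^^ Suc (Suc h)) f)"
    by (simp only: moment_def dot_power_power) (simp add: k mult_2)
  also have "\<dots> = (\<Sum>j\<in>\<sigma>. dot (a j) ((frame_op \<sigma> ^^ h) f) * dot (a j) ((frame_op \<sigma> ^^ Suc h) f))"
    by (simp add: dot_frame_op)
  finally have "moment \<sigma> (Suc k) f =
      (\<Sum>j\<in>\<sigma>. dot (a j) ((frame_op \<sigma> ^^ h) f) * dot (a j) ((frame_op \<sigma> ^^ Suc h) f))" .
  then show ?thesis
    using Cauchy_Schwarz_ineq_sum[of "\<lambda>j. dot (a j) ((frame_op \<sigma> ^^ h) f)"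
        "\<lambda>j. dot (a j) ((frame_op \<sigma> ^^ Suc h) f)" \<sigma>]
      moment_odd[of \<sigma> h f] moment_odd[of \<sigma> "Suc h" f]
    by (simp add: k)
qed

lemmas moment_mult_le = log_convex_mult_le[of "\<lambda>k. moment \<sigma> k f" for \<sigma> f,
    OF moment_nonneg moment_log_convex]

lemmas moment_power_le = log_convex_power_le[of "\<lambda>k. moment \<sigma> k f" for \<sigma> f,
    OF moment_nonneg moment_log_convex]

text \<open>
  Removal of a vector from its own moment. The right side is \<open>\<langle>a, (Y + b)\<^sup>m a\<rangle>\<close> for the frame
  operator \<open>Y\<close> of \<open>\<tau>\<close>. Peeling off one factor \<open>Y + a a\<^sup>T\<close> produces either one more \<open>Y\<close> or a
  splitting into a product of two moments, and log-convexity bounds that product by what the shift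
  \<open>b\<close> contributes.
\<close>

lemma moment_insert_le:
  assumes "finite \<tau>" "j \<notin> \<tau>" and b: "dot (a j) (a j) \<le> b"
  shows "moment (insert j \<tau>) m (a j) \<le>
    (\<Sum>l\<le>m. real (m choose l) * b ^ (m - l) * moment \<tau> l (a j))"
proof -
  let ?x = "a j" and ?Y = "frame_op \<tau>" and ?Z = "frame_op (insert j \<tau>)"
  let ?y = "\<lambda>k. moment \<tau> k (a j)"
  have b0: "0 \<le> b" using b dot_self_nonneg[of ?x] by linarith
  \<comment> \<open>The extra power of \<open>Y\<close> in front collects the factors that have been peeled off.\<close>
  have "dot ?x ((?Y ^^ k) ((?Z ^^ m) ?x)) \<le>
      (\<Sum>l\<le>m. real (m choose l) * b ^ (m - l) * ?y (k + l))" for k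
  proof (induction m arbitrary: k)
    case 0
    show ?case by (simp add: moment_def)
  next
    case (Suc m)
    let ?w = "(?Z ^^ m) ?x"
    have "dot ?x ((?Y ^^ k) ((?Z ^^ Suc m) ?x)) = dot ((?Y ^^ k) ?x) (?Z ?w)"
      by (simp add: frame_op_power_self_adjoint)
    also have "\<dots> = dot ?x ((?Y ^^ k) ?x) * dot ?x ?w + dot ((?Y ^^ k) ?x) (?Y ?w)"
      using assms by (simp add: dot_frame_op)
    also have "dot ((?Y ^^ k) ?x) (?Y ?w) = dot ?x ((?Y ^^ Suc k) ?w)"
      by (simp only: frame_op_power_self_adjoint[symmetric] funpow_Suc_right o_apply)
    also have "dot ?x ((?Y ^^ k) ?x) = ?y k" by (simp add: moment_def)
    finally have split: "dot ?x ((?Y ^^ k) ((?Z ^^ Suc m) ?x)) =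
        ?y k * dot ?x ?w + dot ?x ((?Y ^^ Suc k) ?w)" .
    have "?y k * dot ?x ?w \<le> ?y k * (\<Sum>l\<le>m. real (m choose l) * b ^ (m - l) * ?y l)"
      using Suc.IH[of 0] by (intro mult_left_mono) (simp_all add: moment_nonneg)
    also have "\<dots> = (\<Sum>l\<le>m. real (m choose l) * b ^ (m - l) * (?y k * ?y l))"
      by (simp add: sum_distrib_left mult_ac)
    also have "\<dots> \<le> (\<Sum>l\<le>m. real (m choose l) * b ^ (m - l) * (b * ?y (k + l)))"
    proof (intro sum_mono mult_left_mono)
      fix l
      have "?y k * ?y l \<le> ?y 0 * ?y (k + l)" by (rule moment_mult_le)
      also have "\<dots> \<le> b * ?y (k + l)"
        using b by (intro mult_right_mono moment_nonneg) (simp add: moment_def)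
      finally show "?y k * ?y l \<le> b * ?y (k + l)" .
    qed (use b0 in simp)
    also have "\<dots> = b * (\<Sum>l\<le>m. real (m choose l) * b ^ (m - l) * ?y (k + l))"
      by (simp add: sum_distrib_left mult_ac)
    finally show ?case
      using Suc.IH[of "Suc k"] unfolding split sum_binomial_Suc by simp
  qed
  from this[of 0] show ?thesis by (simp add: moment_def)
qed

section \<open>Traces of powers\<close>

lemma trace_power_Suc: "trace_power \<sigma> (Suc k) = (\<Sum>j\<in>\<sigma>. moment \<sigma> k (a j))"
proof -
  have "trace_power \<sigma> (Suc k) =
      (\<Sum>i\<in>I. \<Sum>j\<in>\<sigma>. dot (a j) (basis i) * dot (a j) ((frame_op \<sigma> ^^ k) (basis i)))"
    by (simp add: trace_power_def moment_def dot_frame_op)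
  also have "\<dots> = (\<Sum>j\<in>\<sigma>. \<Sum>i\<in>I. dot (basis i) (a j) * dot (basis i) ((frame_op \<sigma> ^^ k) (a j)))"
    by (subst sum.swap)
      (intro sum.cong refl arg_cong2[of _ _ _ _ "(*)"] dot_commute dot_frame_op_power_swap)
  finally show ?thesis by (simp add: moment_def dot_Parseval[symmetric])
qed

lemma trace_power_even:
  "trace_power \<sigma> (2 * h) = (\<Sum>i\<in>I. dot ((frame_op \<sigma> ^^ h) (basis i)) ((frame_op \<sigma> ^^ h) (basis i)))"
  by (simp add: trace_power_def moment_even)

lemma moment_even_expand:
  "moment \<sigma> (2 * h) f = (\<Sum>i\<in>I. (dot f ((frame_op \<sigma> ^^ h) (basis i)))\<^sup>2)"
proof -
  have "dot (basis i) ((frame_op \<sigma> ^^ h) f) = dot f ((frame_op \<sigma> ^^ h) (basis i))" for i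
    by (rule dot_frame_op_power_swap)
  then show ?thesis
    unfolding moment_even by (subst dot_Parseval) (simp add: power2_eq_square)
qed

lemma moment_even_le_trace_power:
  "moment \<sigma> (2 * h) f \<le> dot f f * trace_power \<sigma> (2 * h)"
  unfolding moment_even_expand trace_power_even sum_distrib_left
  by (intro sum_mono dot_Cauchy_Schwarz)

lemma trace_power_nonneg: "0 \<le> trace_power \<sigma> k"
  by (simp add: trace_power_def sum_nonneg moment_nonneg)

text \<open>
  The sum is \<open>tr (A A\<^sup>T X\<^sup>k)\<close> for the matrix \<open>A\<close> with columns \<open>a\<^sub>j\<close>, and \<open>A A\<^sup>T \<le> 1\<close>. To avoid a
  square root of \<open>X\<close>, the power \<open>X\<^sup>k\<close> is written as \<open>X\<^sup>h X\<^sup>h\<close> or \<open>X\<^sup>h X X\<^sup>h\<close>; in both cases the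
  sum becomes a sum of squared norms \<open>\<parallel>A\<^sup>T g\<parallel>\<^sup>2\<close>.
\<close>

lemma sum_moment_le_trace_power:
  assumes contraction: "\<And>f. (\<Sum>j\<in>J. (dot (a j) f)\<^sup>2) \<le> dot f f"
  shows "(\<Sum>j\<in>J. moment \<sigma> k (a j)) \<le> trace_power \<sigma> k"
proof (cases "even k")
  case True
  then obtain h where k: "k = 2 * h" by (auto elim: evenE)
  have "(\<Sum>j\<in>J. moment \<sigma> k (a j)) = (\<Sum>i\<in>I. \<Sum>j\<in>J. (dot (a j) ((frame_op \<sigma> ^^ h) (basis i)))\<^sup>2)"
    unfolding k moment_even_expand by (rule sum.swap)
  also have "\<dots> \<le> trace_power \<sigma> k"
    unfolding k trace_power_even by (intro sum_mono contraction)
  finally show ?thesis .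
next
  case False
  then obtain h where k: "k = Suc (2 * h)" by (auto elim: oddE)
  have "(\<Sum>j\<in>J. moment \<sigma> k (a j)) = (\<Sum>i\<in>\<sigma>. \<Sum>j\<in>J. (dot (a j) ((frame_op \<sigma> ^^ h) (a i)))\<^sup>2)"
    unfolding k moment_odd
    by (subst sum.swap) (intro sum.cong refl arg_cong[of _ _ "\<lambda>t. t\<^sup>2"] dot_frame_op_power_swap)
  also have "\<dots> \<le> (\<Sum>i\<in>\<sigma>. moment \<sigma> (2 * h) (a i))"
    unfolding moment_even by (intro sum_mono contraction)
  also have "\<dots> = trace_power \<sigma> k" by (simp add: k trace_power_Suc)
  finally show ?thesis .
qed

text \<open>
  For \<open>v = \<Sum>\<^sub>j\<^sub>\<in>\<^sub>\<sigma> x\<^sub>j a\<^sub>j\<close> with \<open>\<parallel>x\<parallel> \<le> 1\<close>, Cauchy-Schwarz gives \<open>\<langle>v, X v\<rangle> \<ge> \<parallel>v\<parallel>\<^sup>4\<close>: the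
  Rayleigh quotient of \<open>X\<close> at \<open>v\<close> is at least \<open>\<parallel>v\<parallel>\<^sup>2\<close>. By the moment inequality the one of
  \<open>X\<^sup>p\<close> is at least \<open>\<parallel>v\<parallel>\<^sup>2\<^sup>p\<close>, while the trace bounds it from above.
\<close>

lemma norm_power_le_trace_power:
  assumes "even p" "0 < p"
    and v: "\<And>i. i \<in> I \<Longrightarrow> v i = (\<Sum>j\<in>\<sigma>. x j * a j i)"
    and x: "(\<Sum>j\<in>\<sigma>. (x j)\<^sup>2) \<le> 1"
  shows "dot v v ^ p \<le> trace_power \<sigma> p"
proof (cases "dot v v = 0")
  case True
  then show ?thesis using assms(2) trace_power_nonneg[of \<sigma> p] by (simp add: zero_power)
next
  case False
  let ?s = "dot v v"
  have s: "0 < ?s" using False dot_self_nonneg[of v] by simp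
  obtain q where q: "p = Suc q" using assms(2) gr0_implies_Suc by blast
  have "?s = (\<Sum>i\<in>I. \<Sum>j\<in>\<sigma>. x j * (a j i * v i))"
    unfolding dot_def by (intro sum.cong) (simp_all add: v sum_distrib_left sum_distrib_right mult_ac)
  also have "\<dots> = (\<Sum>j\<in>\<sigma>. x j * dot (a j) v)"
    by (subst sum.swap) (simp add: dot_def sum_distrib_left)
  finally have "?s\<^sup>2 \<le> (\<Sum>j\<in>\<sigma>. (x j)\<^sup>2) * (\<Sum>j\<in>\<sigma>. (dot (a j) v)\<^sup>2)"
    using Cauchy_Schwarz_ineq_sum by metis
  also have "\<dots> \<le> 1 * moment \<sigma> 1 v"
    using x moment_odd[of \<sigma> 0 v] by (intro mult_mono) (simp_all add: sum_nonneg)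
  finally have "?s\<^sup>2 \<le> moment \<sigma> 1 v" by simp
  then have "(?s\<^sup>2) ^ p \<le> moment \<sigma> 1 v ^ p" by (intro power_mono) simp_all
  also have "\<dots> \<le> moment \<sigma> 0 v ^ q * moment \<sigma> p v"
    unfolding q by (rule moment_power_le)
  also have "\<dots> \<le> ?s ^ q * (?s * trace_power \<sigma> p)"
    using moment_even_le_trace_power[of \<sigma> "p div 2" v] assms(1) s
    by (simp add: moment_def mult_left_mono)
  finally have "?s ^ p * ?s ^ p \<le> ?s ^ p * trace_power \<sigma> p"
    by (simp add: q mult_ac power2_eq_square power_mult_distrib)
  then show ?thesis using s by simp
qed

text \<open>
  An operator and its transpose have the same norm; the hypothesis concerns \<open>w \<mapsto> \<Sum>\<^sub>j w\<^sub>j a\<^sub>j\<close> and the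
  conclusion its transpose \<open>f \<mapsto> (\<langle>a\<^sub>j, f\<rangle>)\<^sub>j\<close>.
\<close>

lemma contraction_adjoint:
  assumes contraction: "\<And>w. dot (\<lambda>i. \<Sum>j\<in>J. w j * a j i) (\<lambda>i. \<Sum>j\<in>J. w j * a j i) \<le> (\<Sum>j\<in>J. (w j)\<^sup>2)"
  shows "(\<Sum>j\<in>J. (dot (a j) f)\<^sup>2) \<le> dot f f"
proof -
  let ?w = "\<lambda>j. dot (a j) f"
  let ?v = "\<lambda>i. \<Sum>j\<in>J. ?w j * a j i" and ?S = "\<Sum>j\<in>J. (?w j)\<^sup>2"
  have S: "0 \<le> ?S" by (simp add: sum_nonneg)
  have "dot f ?v = ?S"
    using dot_frame_op[of f J f] by (simp add: frame_op_def power2_eq_square)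
  then have "?S\<^sup>2 \<le> dot f f * dot ?v ?v" using dot_Cauchy_Schwarz by metis
  also have "\<dots> \<le> dot f f * ?S" by (intro mult_left_mono contraction dot_self_nonneg)
  finally have "?S * ?S \<le> dot f f * ?S" by (simp add: power2_eq_square)
  then show ?thesis
    using S dot_self_nonneg[of f] by (cases "?S = 0") (simp_all add: mult_le_cancel_right)
qed

section \<open>Averaging over subsets of fixed size\<close>

text \<open>
  Each vector \<open>a\<^sub>j\<close> with \<open>j \<in> \<sigma>\<close> is removed from its own moment, the sum is rearranged according to
  \<open>\<tau> = \<sigma> - {j}\<close>, and the terms with \<open>j \<in> \<tau>\<close>, which are nonnegative, are added.
\<close>

lemma sum_trace_power_Suc_le:
  assumes J: "finite J" and b: "\<And>j. j \<in> J \<Longrightarrow> dot (a j) (a j) \<le> b"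
  shows "(\<Sum>\<sigma> | \<sigma> \<subseteq> J \<and> card \<sigma> = Suc m. trace_power \<sigma> (Suc k)) \<le>
    (\<Sum>l\<le>k. real (k choose l) * b ^ (k - l) *
      (\<Sum>\<tau> | \<tau> \<subseteq> J \<and> card \<tau> = m. \<Sum>j\<in>J. moment \<tau> l (a j)))"
proof -
  let ?g = "\<lambda>j \<tau>. \<Sum>l\<le>k. real (k choose l) * b ^ (k - l) * moment \<tau> l (a j)"
  have g_nonneg: "0 \<le> ?g j \<tau>" if "j \<in> J" for j \<tau>
    using b[OF that] dot_self_nonneg[of "a j"]
    by (intro sum_nonneg mult_nonneg_nonneg) (simp_all add: moment_nonneg)
  have "(\<Sum>\<sigma> | \<sigma> \<subseteq> J \<and> card \<sigma> = Suc m. trace_power \<sigma> (Suc k)) =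
      (\<Sum>\<sigma> | \<sigma> \<subseteq> J \<and> card \<sigma> = Suc m. \<Sum>j\<in>\<sigma>. moment \<sigma> k (a j))"
    by (simp add: trace_power_Suc)
  also have "\<dots> \<le> (\<Sum>\<sigma> | \<sigma> \<subseteq> J \<and> card \<sigma> = Suc m. \<Sum>j\<in>\<sigma>. ?g j (\<sigma> - {j}))"
  proof (intro sum_mono)
    fix \<sigma> j assume \<sigma>: "\<sigma> \<in> {\<sigma>. \<sigma> \<subseteq> J \<and> card \<sigma> = Suc m}" and j: "j \<in> \<sigma>"
    have "finite \<sigma>" using \<sigma> J finite_subset by blast
    then have "moment (insert j (\<sigma> - {j})) k (a j) \<le> ?g j (\<sigma> - {j})"
      using \<sigma> j b by (intro moment_insert_le) auto
    then show "moment \<sigma> k (a j) \<le> ?g j (\<sigma> - {j})" using j by (simp add: insert_absorb)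
  qed
  also have "\<dots> = (\<Sum>\<tau> | \<tau> \<subseteq> J \<and> card \<tau> = m. \<Sum>j\<in>J - \<tau>. ?g j \<tau>)"
    by (rule sum_subsets_remove[OF J])
  also have "\<dots> \<le> (\<Sum>\<tau> | \<tau> \<subseteq> J \<and> card \<tau> = m. \<Sum>j\<in>J. ?g j \<tau>)"
    by (intro sum_mono sum_mono2) (use J g_nonneg in auto)
  also have "\<dots> = (\<Sum>\<tau> | \<tau> \<subseteq> J \<and> card \<tau> = m. \<Sum>l\<le>k. \<Sum>j\<in>J.
      real (k choose l) * b ^ (k - l) * moment \<tau> l (a j))"
    by (intro sum.cong sum.swap refl)
  also have "\<dots> = (\<Sum>l\<le>k. \<Sum>\<tau> | \<tau> \<subseteq> J \<and> card \<tau> = m. \<Sum>j\<in>J.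
      real (k choose l) * b ^ (k - l) * moment \<tau> l (a j))"
    by (rule sum.swap)
  finally show ?thesis by (simp add: sum_distrib_left)
qed

text \<open>
  The shape \<open>(b l + \<delta>)\<^sup>l\<close> survives the recursion because the binomial theorem turns the shift by
  \<open>b\<close> into an increase of \<open>l\<close> by one. The hypothesis on the ratio of binomial coefficients says that
  \<open>\<delta>\<close> dominates the probability that a given index is selected.
\<close>

lemma sum_trace_power_Suc_bound:
  fixes \<delta> :: real
  assumes J: "finite J" and b: "\<And>j. j \<in> J \<Longrightarrow> dot (a j) (a j) \<le> b" and b0: "0 \<le> b" and \<delta>: "0 \<le> \<delta>"
    and ratio: "real (card J choose m) \<le> \<delta> * real (card J choose Suc m)"
    and step: "\<And>l. l \<le> k \<Longrightarrow> (\<Sum>\<tau> | \<tau> \<subseteq> J \<and> card \<tau> = m. \<Sum>j\<in>J. moment \<tau> l (a j)) \<le>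
      real (card J choose m) * (K * (b * real l + \<delta>) ^ l)"
    and K: "0 \<le> K"
  shows "(\<Sum>\<sigma> | \<sigma> \<subseteq> J \<and> card \<sigma> = Suc m. trace_power \<sigma> (Suc k)) \<le>
    real (card J choose Suc m) * (\<delta> * K * (b * real (Suc k) + \<delta>) ^ k)"
proof -
  let ?c = "real (card J choose m)"
  have "(\<Sum>\<sigma> | \<sigma> \<subseteq> J \<and> card \<sigma> = Suc m. trace_power \<sigma> (Suc k)) \<le>
      (\<Sum>l\<le>k. real (k choose l) * b ^ (k - l) * (?c * (K * (b * real k + \<delta>) ^ l)))"
  proof (rule order_trans[OF sum_trace_power_Suc_le[OF J b]], assumption, intro sum_mono mult_left_mono)
    fix l assume "l \<in> {..k}"
    then have l: "l \<le> k" by simp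
    have "(b * real l + \<delta>) ^ l \<le> (b * real k + \<delta>) ^ l"
      using l b0 \<delta> by (intro power_mono add_right_mono mult_left_mono) auto
    then show "(\<Sum>\<tau> | \<tau> \<subseteq> J \<and> card \<tau> = m. \<Sum>j\<in>J. moment \<tau> l (a j)) \<le> ?c * (K * (b * real k + \<delta>) ^ l)"
      using K by (intro order_trans[OF step[OF l]] mult_left_mono) auto
  qed (use b0 in simp)
  also have "\<dots> = ?c * (K * (\<Sum>l\<le>k. real (k choose l) * (b * real k + \<delta>) ^ l * b ^ (k - l)))"
    by (simp add: sum_distrib_left mult_ac)
  also have "(\<Sum>l\<le>k. real (k choose l) * (b * real k + \<delta>) ^ l * b ^ (k - l)) = (b * real (Suc k) + \<delta>) ^ k"
    unfolding binomial_ring[symmetric] by (simp add: algebra_simps)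
  also have "?c * (K * (b * real (Suc k) + \<delta>) ^ k) \<le>
      (\<delta> * real (card J choose Suc m)) * (K * (b * real (Suc k) + \<delta>) ^ k)"
    using ratio K b0 \<delta> by (intro mult_right_mono) auto
  finally show ?thesis by (simp add: mult_ac)
qed

text \<open>
  For \<open>k = 0\<close> the inner sum is bounded by \<open>N b\<close>, \<open>N = card J\<close>, and not by the trace of the
  identity as for the other \<open>k\<close>. The factor \<open>b\<close> is what finally leaves \<open>n\<close>, and not \<open>N\<close>, in front of the \<open>p\<close>-th power, hence \<open>log n\<close> in
  place of \<open>log N\<close>.
\<close>

lemma sum_moment_bound:
  fixes \<delta> :: real
  assumes J: "finite J" and b: "\<And>j. j \<in> J \<Longrightarrow> dot (a j) (a j) \<le> b" and b0: "0 \<le> b" and \<delta>: "0 \<le> \<delta>"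
    and contraction: "\<And>f. (\<Sum>j\<in>J. (dot (a j) f)\<^sup>2) \<le> dot f f"
    and ratio: "\<And>m. m < n \<Longrightarrow> real (card J choose m) \<le> \<delta> * real (card J choose Suc m)"
    and "m \<le> n"
  shows "(\<Sum>\<sigma> | \<sigma> \<subseteq> J \<and> card \<sigma> = m. \<Sum>j\<in>J. moment \<sigma> k (a j)) \<le>
    real (card J choose m) * (real (card J) * b * (b * real k + \<delta>) ^ k)"
  using \<open>m \<le> n\<close>
proof (induction k arbitrary: m rule: less_induct)
  case (less k)
  let ?K = "real (card J) * b"
  have K: "0 \<le> ?K" using b0 by simp
  show ?case
  proof (cases k)
    case 0
    have "(\<Sum>j\<in>J. moment \<sigma> 0 (a j)) \<le> ?K" for \<sigma>
      using sum_bounded_above[of J "\<lambda>j. moment \<sigma> 0 (a j)" b] b by (simp add: moment_def)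
    then have "(\<Sum>\<sigma> | \<sigma> \<subseteq> J \<and> card \<sigma> = m. \<Sum>j\<in>J. moment \<sigma> 0 (a j)) \<le>
        real (card {\<sigma>. \<sigma> \<subseteq> J \<and> card \<sigma> = m}) * ?K"
      by (rule sum_bounded_above[of _ "\<lambda>\<sigma>. \<Sum>j\<in>J. moment \<sigma> 0 (a j)"])
    then show ?thesis using J by (simp add: 0 n_subsets)
  next
    case (Suc k')
    have "(\<Sum>\<sigma> | \<sigma> \<subseteq> J \<and> card \<sigma> = m. \<Sum>j\<in>J. moment \<sigma> k (a j)) \<le>
        (\<Sum>\<sigma> | \<sigma> \<subseteq> J \<and> card \<sigma> = m. trace_power \<sigma> k)"
      by (intro sum_mono sum_moment_le_trace_power contraction)
    also have "\<dots> \<le> real (card J choose m) * (?K * (b * real k + \<delta>) ^ k)"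
    proof (cases m)
      case 0
      have "{\<sigma>. \<sigma> \<subseteq> J \<and> card \<sigma> = 0} = {{}}" using J by (auto dest: finite_subset)
      then show ?thesis using b0 \<delta> by (simp add: 0 Suc trace_power_Suc)
    next
      case (Suc m')
      have "(\<Sum>\<sigma> | \<sigma> \<subseteq> J \<and> card \<sigma> = m. trace_power \<sigma> k) \<le>
          real (card J choose m) * (\<delta> * ?K * (b * real k + \<delta>) ^ k')"
        unfolding Suc \<open>k = Suc k'\<close>
      proof (intro sum_trace_power_Suc_bound J b b0 \<delta> K ratio)
        show "m' < n" using less.prems Suc by simp
      qed (use less Suc \<open>k = Suc k'\<close> in auto)
      also have "\<dots> \<le> real (card J choose m) * (?K * (b * real k + \<delta>) ^ k)"
      proof (intro mult_left_mono)
        have "\<delta> * (?K * (b * real k + \<delta>) ^ k') \<le> (b * real k + \<delta>) * (?K * (b * real k + \<delta>) ^ k')"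
          using b0 \<delta> by (intro mult_right_mono) auto
        then show "\<delta> * ?K * (b * real k + \<delta>) ^ k' \<le> ?K * (b * real k + \<delta>) ^ k"
          by (simp add: \<open>k = Suc k'\<close> mult_ac)
      qed simp
      finally show ?thesis .
    qed
    finally show ?thesis .
  qed
qed

lemma sum_trace_power_bound:
  assumes J: "finite J" and b: "\<And>j. j \<in> J \<Longrightarrow> dot (a j) (a j) \<le> b" and b0: "0 \<le> b"
    and contraction: "\<And>f. (\<Sum>j\<in>J. (dot (a j) f)\<^sup>2) \<le> dot f f"
    and n: "0 < n" "2 * n \<le> card J" and p: "0 < p"
  defines "\<delta> \<equiv> 2 * real n / real (card J)"
  shows "(\<Sum>\<sigma> | \<sigma> \<subseteq> J \<and> card \<sigma> = n. trace_power \<sigma> p) \<le>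
    real (card J choose n) * (2 * real n * (b * real p + \<delta>) ^ p)"
proof -
  let ?N = "card J"
  have \<delta>: "0 \<le> \<delta>" by (simp add: \<delta>_def)
  \<comment> \<open>The exact ratio is \<open>(m + 1) / (N - m)\<close>, and \<open>N - m \<ge> N / 2\<close>.\<close>
  have ratio: "real (?N choose m) \<le> \<delta> * real (?N choose Suc m)" if "m < n" for m
  proof -
    have "real (?N choose m) * (real ?N / 2) \<le> real (?N choose m) * real (?N - m)"
      using n that by (intro mult_left_mono) auto
    also have "\<dots> = real (Suc m) * real (?N choose Suc m)"
      using binomial_absorb_comp[of ?N m] Suc_times_binomial_eq[of "?N - 1" m] n
      by (metis binomial_absorption mult.commute of_nat_mult)
    also have "\<dots> \<le> real n * real (?N choose Suc m)"
      using that by (intro mult_right_mono) auto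
    finally show ?thesis using n by (simp add: \<delta>_def field_simps)
  qed
  obtain m where m: "n = Suc m" using n(1) gr0_implies_Suc by blast
  obtain k where k: "p = Suc k" using p gr0_implies_Suc by blast
  have "(\<Sum>\<sigma> | \<sigma> \<subseteq> J \<and> card \<sigma> = n. trace_power \<sigma> p) \<le>
      real (?N choose n) * (\<delta> * (real ?N * b) * (b * real p + \<delta>) ^ k)"
    unfolding m k
  proof (intro sum_trace_power_Suc_bound J b b0 \<delta> ratio)
    fix l
    show "(\<Sum>\<tau> | \<tau> \<subseteq> J \<and> card \<tau> = m. \<Sum>j\<in>J. moment \<tau> l (a j)) \<le>
        real (?N choose m) * (real ?N * b * (b * real l + \<delta>) ^ l)"
      by (rule sum_moment_bound[OF J b b0 \<delta> contraction ratio]) (use m in auto)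
  qed (use m b0 in auto)
  also have "\<delta> * (real ?N * b) = 2 * real n * b" using n by (simp add: \<delta>_def)
  also have "real (?N choose n) * (2 * real n * b * (b * real p + \<delta>) ^ k) \<le>
      real (?N choose n) * (2 * real n * (b * real p + \<delta>) ^ p)"
  proof -
    have "b * 1 \<le> b * real p + \<delta>"
      using b0 \<delta> p by (intro order_trans[OF mult_left_mono[of 1 "real p" b]]) auto
    then have "b * (b * real p + \<delta>) ^ k \<le> (b * real p + \<delta>) * (b * real p + \<delta>) ^ k"
      using b0 \<delta> by (intro mult_right_mono) auto
    then have "2 * real n * (b * (b * real p + \<delta>) ^ k) \<le> 2 * real n * (b * real p + \<delta>) ^ p"
      unfolding k by (intro mult_left_mono) auto
    then show ?thesis by (intro mult_left_mono) (auto simp: mult_ac)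
  qed
  finally show ?thesis .
qed

end

section \<open>Random coordinate restrictions\<close>

lemma enorm_sq: "x \<in> carrier_vec N \<Longrightarrow> (enorm x)\<^sup>2 = (\<Sum>i<N. (x $ i)\<^sup>2)"
  by (auto simp: enorm_def L2_set_def sum_nonneg)

lemma enorm_nonneg: "0 \<le> enorm x"
  by (simp add: enorm_def)

lemma enorm_smult: "x \<in> carrier_vec N \<Longrightarrow> enorm (c \<cdot>\<^sub>v x) = \<bar>c\<bar> * enorm x"
  by (auto simp: enorm_def L2_set_def power_mult_distrib sum_distrib_left[symmetric] real_sqrt_mult)

lemma enorm_le_opnorm_on:
  assumes "linear_operator N u" "W \<subseteq> carrier_vec N" "x \<in> W" "enorm x \<le> 1"
  shows "enorm (u x) \<le> opnorm_on W u"
  unfolding opnorm_on_def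
  using assms by (intro cSUP_upper bdd_above_opnorm_on) auto

lemma opnorm_on_le:
  assumes "\<sigma> \<subseteq> {..<N}" "\<And>x. x \<in> coord_subspace N \<sigma> \<Longrightarrow> enorm x \<le> 1 \<Longrightarrow> enorm (u x) \<le> c"
  shows "opnorm_on (coord_subspace N \<sigma>) u \<le> c"
  unfolding opnorm_on_def
proof (rule cSUP_least)
  have "0\<^sub>v N \<in> {x \<in> coord_subspace N \<sigma>. enorm x \<le> 1}"
    using assms(1) by (simp add: coord_subspace_eq enorm_def L2_set_def)
  then show "{x \<in> coord_subspace N \<sigma>. enorm x \<le> 1} \<noteq> {}" by blast
qed (use assms(2) in auto)

lemma enorm_image_le:
  assumes u: "linear_operator N u" and norm: "opnorm_on (carrier_vec N) u \<le> 1"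
    and x: "x \<in> carrier_vec N"
  shows "enorm (u x) \<le> enorm x"
proof (cases "enorm x = 0")
  case True
  then have "(\<Sum>i<N. (x $ i)\<^sup>2) = 0" using enorm_sq[OF x] by simp
  then have "x $ i = 0" if "i < N" for i using that by (simp add: sum_nonneg_eq_0_iff)
  then have "u x $ i = 0" if "i < N" for i
    using linear_operator_index[OF u x that] by simp
  moreover have "u x \<in> carrier_vec N" using u x by (auto simp: linear_operator_iff)
  ultimately have "enorm (u x) = 0" by (auto simp: enorm_def L2_set_def)
  then show ?thesis using True by simp
next
  case False
  then have pos: "0 < enorm x" using enorm_nonneg[of x] by simp
  let ?y = "(1 / enorm x) \<cdot>\<^sub>v x"
  have "enorm (u ?y) \<le> 1"
    using norm enorm_le_opnorm_on[OF u subset_refl, of ?y] x pos by (simp add: enorm_smult)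
  moreover have "u ?y = (1 / enorm x) \<cdot>\<^sub>v u x" using u x by (auto simp: linear_operator_iff)
  moreover have "u x \<in> carrier_vec N" using u x by (auto simp: linear_operator_iff)
  ultimately show ?thesis using pos by (simp add: enorm_smult field_simps)
qed

lemma expectation_random_subset:
  assumes "n \<le> N"
  shows "measure_pmf.expectation (random_subset N n) f =
    (\<Sum>\<sigma> | \<sigma> \<subseteq> {..<N} \<and> card \<sigma> = n. f \<sigma>) / real (N choose n)"
proof -
  have "finite {\<sigma>. \<sigma> \<subseteq> {..<N} \<and> card \<sigma> = n}" by simp
  moreover have "card {\<sigma>. \<sigma> \<subseteq> {..<N} \<and> card \<sigma> = n} = N choose n" by (simp add: n_subsets)
  moreover have "{\<sigma>. \<sigma> \<subseteq> {..<N} \<and> card \<sigma> = n} \<noteq> {}"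
    using assms by (auto intro!: exI[of _ "{..<n}"])
  ultimately show ?thesis by (simp add: random_subset_def integral_pmf_of_set)
qed

text \<open>
  The expectation is estimated on the scale \<open>R = 2 sqrt (B\<^sup>2 p + 2 n / N)\<close>. The elementary inequality
  \<open>t \<le> 1 + t\<^sup>2\<^sup>p\<close> for \<open>t = \<parallel>u x\<parallel> / R\<close> takes the place of Jensen's inequality, and the factor
  \<open>4\<^sup>p\<close> in \<open>R\<^sup>2\<^sup>p\<close> absorbs the dimensional factor \<open>n\<close> of the trace bound. For \<open>p\<close> of order
  \<open>log n\<close> the resulting bound is of order \<open>B sqrt (log n) + sqrt (n / N)\<close>.
\<close>

lemma expectation_opnorm_le:
  fixes u :: "real vec \<Rightarrow> real vec"
  assumes u: "linear_operator N u" and norm: "opnorm_on (carrier_vec N) u \<le> 1"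
    and B: "\<And>j. j < N \<Longrightarrow> enorm (u (unit_vec N j)) \<le> B"
    and n: "0 < n" "2 * n \<le> N" and p: "even p" "0 < p" "real n \<le> exp (real p)"
  shows "measure_pmf.expectation (random_subset N n) (\<lambda>\<sigma>. opnorm_on (coord_subspace N \<sigma>) u) \<le>
    6 * sqrt (B\<^sup>2 * real p + 2 * real n / real N)"
proof -
  define a where "a = (\<lambda>j i. u (unit_vec N j) $ i)"
  interpret vector_system "{..<N}" a by standard simp
  let ?E = "measure_pmf.expectation (random_subset N n)"
  let ?P = "{\<sigma>. \<sigma> \<subseteq> {..<N} \<and> card \<sigma> = n}"
  have carrier: "u x \<in> carrier_vec N" if "x \<in> carrier_vec N" for x
    using u that by (auto simp: linear_operator_iff)
  have image: "u x $ i = (\<Sum>j<N. x $ j * a j i)" if "x \<in> carrier_vec N" "i < N" for x i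
    using linear_operator_index[OF u that] by (simp add: a_def)
  have dot_sq: "dot (\<lambda>i. u x $ i) (\<lambda>i. u x $ i) = (enorm (u x))\<^sup>2" if "x \<in> carrier_vec N" for x
    using enorm_sq[OF carrier[OF that]] by (simp add: dot_def power2_eq_square)
  have contraction: "(\<Sum>j<N. (dot (a j) f)\<^sup>2) \<le> dot f f" for f
  proof (rule contraction_adjoint)
    fix w :: "nat \<Rightarrow> real"
    let ?x = "vec N w"
    have "dot (\<lambda>i. \<Sum>j<N. w j * a j i) (\<lambda>i. \<Sum>j<N. w j * a j i) = (enorm (u ?x))\<^sup>2"
      unfolding dot_sq[OF vec_carrier, symmetric] by (simp add: dot_def image)
    also have "\<dots> \<le> (enorm ?x)\<^sup>2"
      by (intro power_mono enorm_image_le[OF u norm] enorm_nonneg) simp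
    also have "\<dots> = (\<Sum>j<N. (w j)\<^sup>2)" by (simp add: enorm_sq[of _ N])
    finally show "dot (\<lambda>i. \<Sum>j<N. w j * a j i) (\<lambda>i. \<Sum>j<N. w j * a j i) \<le> (\<Sum>j<N. (w j)\<^sup>2)" .
  qed
  have b: "dot (a j) (a j) \<le> B\<^sup>2" if "j \<in> {..<N}" for j
    using dot_sq[of "unit_vec N j"] power_mono[OF B enorm_nonneg, of j 2] that
    by (simp add: a_def)
  define s where "s = B\<^sup>2 * real p + 2 * real n / real N"
  define R where "R = 2 * sqrt s"
  have s: "0 < s" using n by (auto simp: s_def intro!: add_nonneg_pos)
  have R: "0 < R" using s by (simp add: R_def)
  have R_power: "R ^ (2 * p) = 4 ^ p * s ^ p"
    using s by (simp add: R_def power_mult power_mult_distrib)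
  have n_le: "real n \<le> 4 ^ p"
  proof -
    have "exp (real p) = exp 1 ^ p" by (simp add: exp_of_nat_mult[symmetric])
    also have "\<dots> \<le> 4 ^ p" using exp_le by (intro power_mono) auto
    finally show ?thesis by (rule order_trans[OF p(3)])
  qed
  have pointwise: "opnorm_on (coord_subspace N \<sigma>) u \<le> R * (1 + trace_power \<sigma> p / R ^ (2 * p))"
    if "\<sigma> \<in> ?P" for \<sigma>
  proof (rule opnorm_on_le)
    show \<sigma>: "\<sigma> \<subseteq> {..<N}" using that by simp
    fix x assume "x \<in> coord_subspace N \<sigma>" and x1: "enorm x \<le> 1"
    then have x: "x \<in> carrier_vec N" and supp: "\<And>i. i < N \<Longrightarrow> i \<notin> \<sigma> \<Longrightarrow> x $ i = 0"
      using \<sigma> by (auto simp: coord_subspace_eq)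
    define t where "t = enorm (u x) / R"
    have t: "0 \<le> t" using R enorm_nonneg[of "u x"] by (simp add: t_def)
    have "(\<Sum>j\<in>\<sigma>. (x $ j)\<^sup>2) \<le> (\<Sum>j<N. (x $ j)\<^sup>2)"
      using \<sigma> by (intro sum_mono2) auto
    also have "\<dots> \<le> 1"
      unfolding enorm_sq[OF x, symmetric] using x1 enorm_nonneg[of x] by (rule power_le_one[rotated])
    finally have x_sq: "(\<Sum>j\<in>\<sigma>. (x $ j)\<^sup>2) \<le> 1" .
    have "u x $ i = (\<Sum>j\<in>\<sigma>. x $ j * a j i)" if "i \<in> {..<N}" for i
      using image[OF x, of i] that supp \<sigma>
      by (simp add: sum.mono_neutral_right[of "{..<N}" \<sigma>])
    then have "dot (\<lambda>i. u x $ i) (\<lambda>i. u x $ i) ^ p \<le> trace_power \<sigma> p"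
      by (intro norm_power_le_trace_power[OF p(1,2) _ x_sq])
    then have "enorm (u x) ^ (2 * p) \<le> trace_power \<sigma> p"
      by (simp add: dot_sq[OF x] power_mult)
    then have "t ^ (2 * p) \<le> trace_power \<sigma> p / R ^ (2 * p)"
      using R by (simp add: t_def power_divide divide_right_mono)
    moreover have "t \<le> 1 + t ^ (2 * p)"
    proof (cases "t \<le> 1")
      case True
      then show ?thesis using t by (simp add: add_increasing2)
    next
      case False
      then have "t \<le> t ^ (2 * p)" using p(2) by (intro self_le_power) auto
      then show ?thesis by simp
    qed
    ultimately have "t \<le> 1 + trace_power \<sigma> p / R ^ (2 * p)" by linarith
    then show "enorm (u x) \<le> R * (1 + trace_power \<sigma> p / R ^ (2 * p))"
      using R by (simp add: t_def pos_divide_le_eq mult.commute)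
  qed
  let ?c = "real (N choose n)"
  have c: "0 < ?c" using n by simp
  have "(\<Sum>\<sigma>\<in>?P. opnorm_on (coord_subspace N \<sigma>) u) \<le>
      (\<Sum>\<sigma>\<in>?P. R * (1 + trace_power \<sigma> p / R ^ (2 * p)))"
    by (intro sum_mono pointwise)
  also have "\<dots> = R * (?c + (\<Sum>\<sigma>\<in>?P. trace_power \<sigma> p) / R ^ (2 * p))"
    by (simp add: sum_distrib_left[symmetric] sum.distrib sum_divide_distrib[symmetric] n_subsets)
  also have "\<dots> \<le> R * (?c + ?c * (2 * real n * s ^ p) / R ^ (2 * p))"
    using R sum_trace_power_bound[OF _ b _ contraction, of n p] n p
    by (intro mult_left_mono add_left_mono divide_right_mono) (simp_all add: s_def)
  also have "\<dots> \<le> R * (?c + ?c * 2)"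
  proof (intro mult_left_mono add_left_mono)
    have "2 * real n * s ^ p \<le> 2 * R ^ (2 * p)"
      unfolding R_power using n_le s by (simp add: mult_right_mono)
    then have "?c * (2 * real n * s ^ p) \<le> ?c * (2 * R ^ (2 * p))"
      by (intro mult_left_mono) auto
    then show "?c * (2 * real n * s ^ p) / R ^ (2 * p) \<le> ?c * 2"
      using R by (simp add: pos_divide_le_eq mult_ac)
  qed (use R in simp_all)
  also have "\<dots> = 6 * sqrt s * ?c" by (simp add: R_def)
  finally show ?thesis
    using n c by (simp add: expectation_random_subset pos_divide_le_eq s_def)
qed

theorem proposition1p1:
  shows "\<exists>C>0. \<forall>(N::nat) (n::nat) (u :: real vec \<Rightarrow> real vec).
    linear_operator N u \<and> opnorm_on (carrier_vec N) u = 1 \<and> 2 \<le> n \<and> n \<le> N \<longrightarrow>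
    measure_pmf.expectation (random_subset N n) (\<lambda>\<sigma>. opnorm_on (coord_subspace N \<sigma>) u)
      \<le> C * ln (real n) * (sqrt (real n / real N) + (MAX j\<in>{..<N}. enorm (u (unit_vec N j))))"
proof (intro exI[of _ 30] conjI allI impI; (elim conjE)?)
  fix N n :: nat and u :: "real vec \<Rightarrow> real vec"
  assume u: "linear_operator N u" and norm: "opnorm_on (carrier_vec N) u = 1"
    and n: "2 \<le> n" "n \<le> N"
  let ?E = "measure_pmf.expectation (random_subset N n) (\<lambda>\<sigma>. opnorm_on (coord_subspace N \<sigma>) u)"
  define B where "B = (MAX j\<in>{..<N}. enorm (u (unit_vec N j)))"
  define r where "r = sqrt (real n / real N)"
  define l where "l = ln (real n)"
  have B: "enorm (u (unit_vec N j)) \<le> B" if "j < N" for j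
    unfolding B_def using that by (intro Max_ge) auto
  have B0: "0 \<le> B" using B[of 0] enorm_nonneg[of "u (unit_vec N 0)"] n by linarith
  have r0: "0 \<le> r" and r2: "r\<^sup>2 = real n / real N" by (simp_all add: r_def)
  have "ln 2 \<le> l" using n by (simp add: l_def)
  then have l: "2 / 3 \<le> l" using ln2_ge_two_thirds by linarith
  have "?E \<le> 30 * l * (r + B)"
  proof (cases "2 * n \<le> N")
    case True
    \<comment> \<open>The least even number with \<open>p / 2 \<ge> ln n\<close>; it is at most \<open>5 ln n\<close> since \<open>ln n \<ge> 2 / 3\<close>.\<close>
    define p where "p = 2 * nat \<lceil>l\<rceil>"
    have "0 < nat \<lceil>l\<rceil>" using l by simp
    then have p: "even p" "0 < p" by (simp_all add: p_def)
    have p_ge: "l \<le> real p" using l by (simp add: p_def) linarith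
    have p_le: "real p \<le> 5 * l" using l by (simp add: p_def) linarith
    have "real n = exp l" using n by (simp add: l_def)
    then have "real n \<le> exp (real p)" using p_ge by simp
    then have "?E \<le> 6 * sqrt (B\<^sup>2 * real p + 2 * real n / real N)"
      using u norm B n True p by (intro expectation_opnorm_le) auto
    also have "sqrt (B\<^sup>2 * real p + 2 * real n / real N) \<le> 5 * l * (r + B)"
    proof (rule real_le_lsqrt)
      have "B\<^sup>2 * real p + 2 * real n / real N = B\<^sup>2 * real p + 2 * r\<^sup>2" by (simp add: r2)
      also have "\<dots> \<le> B\<^sup>2 * (5 * l) + 5 * l * r\<^sup>2"
        using p_le l by (intro add_mono mult_left_mono mult_right_mono) auto
      also have "\<dots> \<le> 5 * l * (r + B)\<^sup>2"
        using B0 r0 l by (simp add: power2_sum algebra_simps)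
      also have "\<dots> \<le> (5 * l)\<^sup>2 * (r + B)\<^sup>2"
        using l by (intro mult_right_mono) (simp_all add: power2_eq_square)
      finally show "B\<^sup>2 * real p + 2 * real n / real N \<le> (5 * l * (r + B))\<^sup>2"
        by (simp add: power_mult_distrib)
    qed (use l r0 B0 in simp)
    finally show ?thesis by simp
  next
    case False
    have "opnorm_on (coord_subspace N \<sigma>) u \<le> 1" if "\<sigma> \<subseteq> {..<N}" for \<sigma>
      using that enorm_le_opnorm_on[OF u subset_refl] norm
      by (intro opnorm_on_le) (auto simp: coord_subspace_eq)
    then have "(\<Sum>\<sigma> | \<sigma> \<subseteq> {..<N} \<and> card \<sigma> = n. opnorm_on (coord_subspace N \<sigma>) u) \<le>
        real (card {\<sigma>. \<sigma> \<subseteq> {..<N} \<and> card \<sigma> = n}) * 1"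
      by (intro sum_bounded_above) simp
    then have "?E \<le> 1"
      using n by (simp add: expectation_random_subset pos_divide_le_eq n_subsets)
    also have "1 \<le> 30 * (2 / 3) * (1 / 2 :: real)" by simp
    also have "\<dots> \<le> 30 * l * (r + B)"
    proof (intro mult_mono)
      have "1 / 2 \<le> r"
        unfolding r_def by (rule real_le_rsqrt) (use False n in \<open>simp add: power2_eq_square field_simps\<close>)
      then show "1 / 2 \<le> r + B" using B0 by simp
    qed (use l in auto)
    finally show ?thesis .
  qed
  then show "?E \<le> 30 * ln (real n) * (sqrt (real n / real N) + (MAX j\<in>{..<N}. enorm (u (unit_vec N j))))"
    by (simp add: l_def r_def B_def)
qed simp

end
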